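(* Let $\ell\ge 2$ be an integer and let $G$ be a graph of order $n>\binom{\ell+1}{2}(2\ell+1)(3\ell-1)$ with minimum degree $\delta>\frac{2n}{2\ell+1}$, such that deleting any collection of at most $\ell^3$ edges of $G$ does not result in a bipartite graph. Then $G$ contains the cycle $C_{2\ell-1}$ as a subgraph.
   Context: Graphs are finite and simple; $C_m$ denotes the cycle of length $m$. *)

theory Defs
  imports Complex_Main
begin

record 'a ugraph =
  verts :: "'a set"
  edges :: "'a set set"

definition simple_graph :: "'a ugraph \<Rightarrow> bool" where
  "simple_graph G \<longleftrightarrow> finite (verts G) \<and> (\<forall>e\<in>edges G. e \<subseteq> verts G \<and> card e = 2)"

definition order :: "'a ugraph \<Rightarrow> nat" where
  "order G = card (verts G)"

definition degree :: "'a ugraph \<Rightarrow> 'a \<Rightarrow> nat" where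
  "degree G v = card {e \<in> edges G. v \<in> e}"

text \<open>Meaningful only for finite graphs with at least one vertex.\<close>

definition min_degree :: "'a ugraph \<Rightarrow> nat" where
  "min_degree G = Min (degree G ` verts G)"

definition bipartite :: "'a ugraph \<Rightarrow> bool" where
  "bipartite G \<longleftrightarrow> (\<exists>A B. A \<union> B = verts G \<and> A \<inter> B = {} \<and>
     (\<forall>e\<in>edges G. \<exists>a\<in>A. \<exists>b\<in>B. e = {a, b}))"

definition delete_edges :: "'a ugraph \<Rightarrow> 'a set set \<Rightarrow> 'a ugraph" where
  "delete_edges G F = G\<lparr>edges := edges G - F\<rparr>"

text \<open>The cycle of length \<open>m\<close>; intended for \<open>m \<ge> 3\<close>.\<close>

definition cycle_graph :: "nat \<Rightarrow> nat ugraph" where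
  "cycle_graph m = \<lparr>verts = {..<m}, edges = {{i, Suc i mod m} | i. i < m}\<rparr>"

text \<open>Containment as a not necessarily induced subgraph, up to isomorphism:
  \<open>f\<close> maps \<open>H\<close> isomorphically onto a subgraph of \<open>G\<close>.\<close>

definition contains_subgraph :: "'a ugraph \<Rightarrow> 'b ugraph \<Rightarrow> bool" where
  "contains_subgraph G H \<longleftrightarrow> (\<exists>f. inj_on f (verts H) \<and> f ` verts H \<subseteq> verts G \<and>
     (\<forall>e\<in>edges H. f ` e \<in> edges G))"

end

theory Submission
  imports Defs
begin

text \<open>
  Call two vertices linked (\<open>H\<close>) if they have at least \<open>3 * l - 1\<close> common neighbours. By the degree
  condition and Bonferroni's inequality, any \<open>l + 1\<close> vertices contain a linked pair. Call a path
  good if it has an odd number of edges and linked ends.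

  A good path with fewer than \<open>2 * l - 3\<close> edges can be extended by two: the common neighbours of its
  ends that lie off the path contain a linked pair, which becomes the new pair of ends. A good path with
  \<open>2 * l - 3\<close> edges closes up to the required cycle through one more common neighbour.

  A shortest good path together with a common neighbour of its ends is an odd cycle on which only
  vertices at distance 2 are linked, so its length is at most \<open>2 * l + 1\<close>. If the length is
  \<open>2 * l + 1\<close>, then all vertices at distance 2 are linked, minimality leaves every vertex of the
  graph at most two neighbours on the cycle, and this contradicts the degree condition.

  If there is no good path, then the parities of the paths between two vertices do not change
  when an end is replaced by a linked vertex. A maximal set of pairwise unlinked vertices
  splits the graph into at most \<open>l\<close> classes. An odd cycle cannot use an edge for which a second edge
  joins the same two classes, so deleting the edges that are alone between their classes, at most
  \<open>l\<^sup>2\<close> in number, leaves a bipartite graph.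
\<close>

section \<open>Paths and cycles\<close>

text \<open>Paths and cycles are lists of vertices, so a path has \<open>length xs - 1\<close>
  edges, and a cycle has \<open>length xs\<close> edges once there are at least three vertices. A
  list of two adjacent vertices may pass as a cycle, but for irreflexive \<open>E\<close> an odd
  cycle has at least three vertices.\<close>

definition path :: "('a \<Rightarrow> 'a \<Rightarrow> bool) \<Rightarrow> 'a list \<Rightarrow> 'a \<Rightarrow> 'a \<Rightarrow> bool" where
  "path E xs x y \<longleftrightarrow> xs \<noteq> [] \<and> hd xs = x \<and> last xs = y \<and> distinct xs \<and> successively E xs"

definition cycle :: "('a \<Rightarrow> 'a \<Rightarrow> bool) \<Rightarrow> 'a list \<Rightarrow> bool" where
  "cycle E xs \<longleftrightarrow> xs \<noteq> [] \<and> distinct xs \<and> successively E xs \<and> E (last xs) (hd xs)"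

lemma path_singleton: "path E [x] x x"
  by (simp add: path_def)

lemma path_prefix: "path E (as @ y # bs) x z \<Longrightarrow> path E (as @ [y]) x y"
  by (auto simp: path_def successively_append_iff hd_append)

lemma path_suffix: "path E (as @ y # bs) x z \<Longrightarrow> path E (y # bs) y z"
  by (auto simp: path_def successively_append_iff)

lemma path_Cons: "path E xs x y \<Longrightarrow> E u x \<Longrightarrow> u \<notin> set xs \<Longrightarrow> path E (u # xs) u y"
  by (auto simp: path_def successively_Cons)

lemma path_snoc: "path E xs x y \<Longrightarrow> E y u \<Longrightarrow> u \<notin> set xs \<Longrightarrow> path E (xs @ [u]) x u"
  by (auto simp: path_def successively_append_iff)

lemma path_join:
  assumes "path E xs x y" "path E (y # ys) y z" "set xs \<inter> set ys = {}"
  shows "path E (xs @ ys) x z"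
  using assms by (cases ys) (auto simp: path_def successively_append_iff)

lemma path_rev:
  assumes "symp E" "path E xs x y"
  shows "path E (rev xs) y x"
proof -
  have "successively (\<lambda>x y. E y x) xs"
    using assms by (auto simp: path_def elim!: successively_mono dest: sympD)
  then show ?thesis
    using assms by (simp add: path_def hd_rev last_rev)
qed

lemma path_closed: "path E xs x x \<Longrightarrow> xs = [x]"
  by (cases xs) (auto simp: path_def split: if_splits)

lemma cycle_rotate: "cycle E (as @ bs) \<Longrightarrow> cycle E (bs @ as)"
  by (cases "as = []"; cases "bs = []") (auto simp: cycle_def successively_append_iff)

text \<open>The two arcs between \<open>a\<close> and \<open>b\<close> share exactly their ends, so
  together they have \<open>length os + 2\<close> vertices. This number is odd, so one arc has each
  parity.\<close>

lemma odd_cycle_path_parity: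
  assumes "symp E" and cyc: "cycle E os" and odd: "odd (length os)"
    and a: "a \<in> set os" and b: "b \<in> set os" and "a \<noteq> b"
  shows "\<exists>xs. path E xs a b \<and> set xs \<subseteq> set os \<and> even (length xs) = \<beta>"
proof -
  obtain as bs where os: "os = as @ a # bs"
    using a by (meson split_list)
  have cyc': "cycle E ((a # bs) @ as)"
    using cyc cycle_rotate[of E as "a # bs"] os by simp
  have "b \<in> set (bs @ as)"
    using b os \<open>a \<noteq> b\<close> by auto
  then obtain cs ds where bsas: "bs @ as = cs @ b # ds"
    by (meson split_list)
  have C: "cycle E (a # cs @ b # ds)"
    using cyc' bsas by simp
  have len: "length os = length cs + length ds + 2"
    using arg_cong[OF bsas, of length] os by simp
  have sub: "set (a # cs @ b # ds) = set os"
    using arg_cong[OF bsas, of set] os by auto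
  have "path E (a # cs @ b # ds) a (last (b # ds))"
    using C by (simp add: cycle_def path_def)
  then have p1: "path E (a # cs @ [b]) a b" and p2: "path E (b # ds) b (last (b # ds))"
    using path_prefix[of E "a # cs" b ds] path_suffix[of E "a # cs" b ds] by simp_all
  have "path E (b # ds @ [a]) b a"
    using path_snoc[OF p2, of a] C by (auto simp: cycle_def)
  then have p3: "path E (rev (b # ds @ [a])) a b"
    by (rule path_rev[OF \<open>symp E\<close>])
  show ?thesis
  proof (cases "even (length cs) = \<beta>")
    case True
    then show ?thesis
      using p1 sub by (intro exI[of _ "a # cs @ [b]"]) auto
  next
    case False
    then show ?thesis
      using p3 sub len odd by (intro exI[of _ "rev (b # ds @ [a])"]) auto
  qed
qed

section \<open>Odd closed walks, odd cycles and two-colourings\<close>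

lemma closed_walk_odd_cycle:
  assumes "successively E ws" "ws \<noteq> []" "E (last ws) (hd ws)" "odd (length ws)"
  shows "\<exists>os. cycle E os \<and> odd (length os)"
  using assms
proof (induction "length ws" arbitrary: ws rule: less_induct)
  case less
  show ?case
  proof (cases "distinct ws")
    case True
    then show ?thesis
      using less.prems by (auto simp: cycle_def)
  next
    case False
    \<comment> \<open>A repeated vertex splits the closed walk into the closed walks
      \<open>x # bs\<close> and \<open>as @ x # cs\<close>. Both are shorter and one of them is
      odd.\<close>
    then obtain as bs cs x where ws: "ws = as @ [x] @ bs @ [x] @ cs"
      using not_distinct_decomp by blast
    show ?thesis
    proof (cases "odd (length (x # bs))")
      case True
      then show ?thesis
        using less.prems ws by (intro less.hyps[of "x # bs"]) (auto simp: successively_append_iff successively_Cons hd_append split: if_splits)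
    next
      case False
      then show ?thesis
        using less.prems ws
        by (intro less.hyps[of "as @ x # cs"])
           (auto simp: successively_append_iff successively_Cons hd_append split: if_splits)
    qed
  qed
qed

lemma relpowp_sym: "symp E \<Longrightarrow> (E ^^ n) x y \<Longrightarrow> (E ^^ n) y x"
proof (induction n arbitrary: y)
  case (Suc n)
  then obtain z where "(E ^^ n) x z" "E z y" by auto
  then show ?case
    using Suc by (meson relpowp_Suc_I2 sympD)
qed auto

lemma odd_relpowp_odd_cycle:
  assumes "(E ^^ n) x x" "odd n"
  shows "\<exists>os. cycle E os \<and> odd (length os)"
proof -
  obtain f where f: "f 0 = x" "f n = x" "\<And>i. i < n \<Longrightarrow> E (f i) (f (Suc i))"
    using assms(1) by (auto simp: relpowp_fun_conv)
  have "n > 0"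
    using \<open>odd n\<close> by (auto intro: Nat.gr0I)
  show ?thesis
  proof (rule closed_walk_odd_cycle[of E "map f [0..<n]"])
    show "successively E (map f [0..<n])"
      using f by (auto simp: successively_conv_nth)
    show "E (last (map f [0..<n])) (hd (map f [0..<n]))"
      using f(3)[of "n - 1"] f(1,2) \<open>n > 0\<close> by (simp add: last_map hd_map)
  qed (use assms \<open>n > 0\<close> in auto)
qed

lemma no_odd_cycle_two_colouring:
  assumes sym: "symp E" and none: "\<And>os. cycle E os \<Longrightarrow> even (length os)"
  shows "\<exists>A. \<forall>x y. E x y \<longrightarrow> (x \<in> A \<longleftrightarrow> y \<notin> A)"
proof -
  \<comment> \<open>The choice depends only on the set of vertices that reach \<open>x\<close>, so
    adjacent vertices get the same root. The colour is the parity of a walk from the root.\<close>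
  define root where "root x = (SOME r. E\<^sup>*\<^sup>* r x)" for x
  define A where "A = {x. \<exists>k. even k \<and> (E ^^ k) (root x) x}"
  have reach: "\<exists>k. (E ^^ k) (root x) x" for x
    unfolding root_def by (metis (mono_tags, lifting) rtranclp.rtrancl_refl rtranclp_power someI)
  have "x \<in> A \<longleftrightarrow> y \<notin> A" if "E x y" for x y
  proof -
    have "E\<^sup>*\<^sup>* r x \<longleftrightarrow> E\<^sup>*\<^sup>* r y" for r
      using that sym by (meson rtranclp.rtrancl_into_rtrancl sympD)
    then have root: "root x = root y"
      by (simp add: root_def)
    have parity: "even i \<noteq> even j" if "(E ^^ i) (root x) x" "(E ^^ j) (root y) y" for i j
    proof (rule ccontr)
      assume *: "\<not> even i \<noteq> even j"
      have "(E ^^ Suc i) (root x) y"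
        using that \<open>E x y\<close> by auto
      then have "(E ^^ (Suc i + j)) (root x) (root x)"
        using relpowp_sym[OF sym that(2)] root by (auto simp only: relpowp_add relcompp_apply)
      then show False
        using odd_relpowp_odd_cycle none * by (metis even_Suc even_add)
    qed
    show ?thesis
      using parity reach unfolding A_def mem_Collect_eq by metis
  qed
  then show ?thesis
    by blast
qed

section \<open>Cyclic indexing and arcs of a cycle\<close>

definition cyc_nth :: "'a list \<Rightarrow> nat \<Rightarrow> 'a" where
  "cyc_nth xs i = xs ! (i mod length xs)"

lemma cyc_nth_add_length: "cyc_nth xs (i + length xs) = cyc_nth xs i"
  by (simp add: cyc_nth_def)

lemma cyc_nth_eq_iff:
  assumes "distinct xs" "k < length xs" "m < length xs"
  shows "cyc_nth xs (i + k) = cyc_nth xs (i + m) \<longleftrightarrow> k = m"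
proof -
  have *: "k' = m'" if "k' \<le> m'" "m' < length xs" "(i + m') mod length xs = (i + k') mod length xs" for k' m'
  proof -
    have "length xs dvd m' - k'"
      using that mod_eq_dvd_iff_nat[of "i + k'" "i + m'" "length xs"] by auto
    then show ?thesis
      using that by (metis diff_is_0_eq dvd_imp_le le_antisym le_less_trans less_imp_diff_less not_less zero_less_iff_neq_zero)
  qed
  have "xs \<noteq> []"
    using assms by auto
  then have "cyc_nth xs (i + k) = cyc_nth xs (i + m) \<longleftrightarrow> (i + k) mod length xs = (i + m) mod length xs"
    unfolding cyc_nth_def using assms(1) by (intro nth_eq_iff_index_eq) auto
  then show ?thesis
    using *[of k m] *[of m k] assms by (metis nat_le_linear)
qed

lemma cyc_nth_step:
  assumes "cycle E xs"
  shows "E (cyc_nth xs i) (cyc_nth xs (Suc i))"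
proof (cases "Suc (i mod length xs) = length xs")
  case True
  then have "length xs - 1 = i mod length xs" "Suc i mod length xs = 0"
    by (linarith, simp add: mod_Suc)
  then have "last xs = cyc_nth xs i" "hd xs = cyc_nth xs (Suc i)"
    using assms by (simp_all add: cyc_nth_def cycle_def last_conv_nth hd_conv_nth)
  then show ?thesis
    using assms by (simp add: cycle_def)
next
  case False
  then have "Suc (i mod length xs) < length xs"
    using assms by (metis Suc_lessI cycle_def length_greater_0_conv mod_less_divisor)
  then show ?thesis
    using assms False by (auto simp: cyc_nth_def cycle_def mod_Suc successively_conv_nth)
qed

text \<open>Indices are reduced only inside \<open>cyc_nth\<close>, so an arc that runs past the end
  of the list is still an interval of natural numbers.\<close>

lemma cycle_arc:
  assumes "cycle E xs" "k < length xs"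
  shows "path E (map (cyc_nth xs) [i..<Suc (i + k)]) (cyc_nth xs i) (cyc_nth xs (i + k))"
proof -
  have "inj_on (cyc_nth xs) {i..<Suc (i + k)}"
  proof (rule inj_onI)
    fix a b
    assume "a \<in> {i..<Suc (i + k)}" "b \<in> {i..<Suc (i + k)}" "cyc_nth xs a = cyc_nth xs b"
    moreover from this have "a - i < length xs" "b - i < length xs"
      using assms by auto
    ultimately show "a = b"
      using cyc_nth_eq_iff[of xs "a - i" "b - i" i] assms by (auto simp: cycle_def)
  qed
  then show ?thesis
    using assms cyc_nth_step[OF assms(1)]
    by (auto simp: path_def distinct_map hd_map last_map successively_conv_nth simp del: upt_Suc)
qed

section \<open>Parities of paths\<close>

locale linked_graph =
  fixes V :: "'a set" and E :: "'a \<Rightarrow> 'a \<Rightarrow> bool" and l :: nat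
  assumes finite_V: "finite V"
    and sym_E: "symp E"
    and irrefl_E: "\<not> E x x"
    and E_in_V: "E x y \<Longrightarrow> x \<in> V"
    and l_ge_2: "l \<ge> 2"
begin

definition nbrs :: "'a \<Rightarrow> 'a set" where
  "nbrs x = {y. E x y}"

text \<open>The threshold leaves at least \<open>l + 1\<close> common neighbours outside any set of
  at most \<open>2 * l - 2\<close> vertices.\<close>

definition H :: "'a \<Rightarrow> 'a \<Rightarrow> bool" where
  "H x y \<longleftrightarrow> x \<noteq> y \<and> 3 * l - 1 \<le> card (nbrs x \<inter> nbrs y)"

text \<open>Parities are those of the number of vertices, which has the opposite parity of the number of edges.\<close>

definition good :: "'a list \<Rightarrow> bool" where
  "good xs \<longleftrightarrow> path E xs (hd xs) (last xs) \<and> even (length xs) \<and> H (hd xs) (last xs)"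

lemma E_sym: "E x y \<Longrightarrow> E y x"
  using sym_E by (rule sympD)

lemma E_neq: "E x y \<Longrightarrow> x \<noteq> y"
  using irrefl_E by auto

lemma H_sym: "H x y \<Longrightarrow> H y x"
  by (auto simp: H_def Int_commute)

lemma symp_H: "symp H"
  by (simp add: H_sym sympI)

lemma finite_nbrs: "finite (nbrs x)"
  using finite_V E_in_V E_sym by (metis finite_subset mem_Collect_eq nbrs_def subsetI)

lemma goodI: "path E xs x y \<Longrightarrow> even (length xs) \<Longrightarrow> H x y \<Longrightarrow> good xs"
  by (auto simp: good_def path_def)

lemma H_common_nbr:
  assumes "H x y" "finite S" "card S < 3 * l - 1"
  obtains w where "E x w" "E y w" "w \<notin> S"
proof -
  have "\<not> nbrs x \<inter> nbrs y \<subseteq> S"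
    using assms card_mono[of S "nbrs x \<inter> nbrs y"] by (auto simp: H_def)
  then show ?thesis
    using that by (auto simp: nbrs_def)
qed

definition joined :: "bool \<Rightarrow> 'a \<Rightarrow> 'a \<Rightarrow> bool" where
  "joined \<beta> x y \<longleftrightarrow> (\<exists>xs. path E xs x y \<and> even (length xs) = \<beta>)"

lemma joined_sym: "joined \<beta> x y \<Longrightarrow> joined \<beta> y x"
  unfolding joined_def using path_rev[OF sym_E] by (metis length_rev)

text \<open>Every path from \<open>x\<close> to \<open>y\<close> has an odd number of vertices, as
  it would be good otherwise. If \<open>y\<close> lies on the given path, cutting off the part
  before \<open>y\<close> keeps the parity. If not, take a common neighbour \<open>w\<close>: off
  the path, prepending \<open>y, w\<close> adds two vertices; on the path, the part up to
  \<open>w\<close> followed by \<open>y\<close> is a path from \<open>x\<close> to \<open>y\<close>,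
  so replacing the part before \<open>w\<close> by \<open>y\<close> keeps the parity.\<close>

lemma joined_transfer:
  assumes none: "\<And>xs. \<not> good xs" and "H x y" and "joined \<beta> x z"
  shows "joined \<beta> y z"
proof -
  obtain xs where xs: "path E xs x z" and parity: "even (length xs) = \<beta>"
    using assms(3) by (auto simp: joined_def)
  have odd: "odd (length ys)" if "path E ys x y" for ys
    using none goodI[OF that _ \<open>H x y\<close>] by blast
  show ?thesis
  proof (cases "y \<in> set xs")
    case True
    then obtain as bs where s: "xs = as @ y # bs"
      by (meson split_list)
    then have "even (length as)"
      using odd[of "as @ [y]"] path_prefix xs by force
    then show ?thesis
      unfolding joined_def using path_suffix[of E as y bs x z] xs s parity
      by (intro exI[of _ "y # bs"]) auto
  next
    case y: False
    obtain w where w: "E x w" "E y w"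
      using H_common_nbr[OF \<open>H x y\<close>, of "{}"] l_ge_2 by auto
    show ?thesis
    proof (cases "w \<in> set xs")
      case False
      have "path E (y # w # xs) y z"
        using xs w y False by (intro path_Cons[where x = w] path_Cons[where x = x]) (auto simp: E_sym E_neq)
      then show ?thesis
        unfolding joined_def using parity by (intro exI[of _ "y # w # xs"]) auto
    next
      case True
      then obtain as bs where s: "xs = as @ w # bs"
        by (meson split_list)
      have "path E ((as @ [w]) @ [y]) x y"
        using xs s w y by (intro path_snoc[OF path_prefix[of E as w bs x z]]) (auto simp: E_sym)
      then have as: "odd (length as)"
        using odd by fastforce
      have "path E (y # w # bs) y z"
        using xs s w y by (intro path_Cons[OF path_suffix[of E as w bs x z]]) (auto simp: E_sym)
      then show ?thesis
        unfolding joined_def using parity as s by (intro exI[of _ "y # w # bs"]) auto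
    qed
  qed
qed

lemma joined_transfer_rtranclp:
  assumes none: "\<And>xs. \<not> good xs" and "H\<^sup>*\<^sup>* x y" and "joined \<beta> x z"
  shows "joined \<beta> y z"
  using assms(2,3) by (induction rule: rtranclp_induct) (auto intro: joined_transfer[OF none])

text \<open>Both claims come from transferring to the case of equal ends, where the only path is the
  single vertex.\<close>

lemma linked_joined:
  assumes none: "\<And>xs. \<not> good xs" and H: "H\<^sup>*\<^sup>* x y"
  shows "joined False x y" and "\<not> joined True x y"
proof -
  have "joined False x x"
    unfolding joined_def using path_singleton[of E x] by (intro exI[of _ "[x]"]) auto
  then show "joined False x y"
    using joined_transfer_rtranclp[OF none H] joined_sym by blast
  show "\<not> joined True x y"
  proof
    assume "joined True x y"
    then have "joined True y y"
      using joined_transfer_rtranclp[OF none H] by blast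
    then show False
      using path_closed[of E _ y] by (fastforce simp: joined_def)
  qed
qed

text \<open>The ear \<open>R\<close> leaves the cycle at \<open>p\<close>, and an odd cycle offers
  both parities between distinct vertices. So \<open>R\<close> extends backwards to a path from
  \<open>v\<close> to \<open>y\<close> if \<open>p = v'\<close>, and \<open>R\<close> with
  \<open>z\<close> to a path from \<open>v'\<close> to \<open>z\<close> otherwise, each with an even
  number of vertices. Linked ends forbid this.\<close>

lemma odd_cycle_no_ear:
  assumes none: "\<And>xs. \<not> good xs"
    and cyc: "cycle E os" and odd: "odd (length os)"
    and v: "v \<in> set os" "v' \<in> set os" "v \<noteq> v'"
    and R: "path E (p # R) p y" "p \<in> set os" "set R \<inter> set os = {}"
    and z: "z \<notin> set (p # R)" "z \<notin> set os" and "E y z"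
    and H: "H\<^sup>*\<^sup>* v y" "H\<^sup>*\<^sup>* v' z"
  shows False
proof (cases "p = v'")
  case True
  obtain xs where xs: "path E xs v v'" "set xs \<subseteq> set os" "even (length xs) = even (length R)"
    using odd_cycle_path_parity[OF sym_E cyc odd v] by blast
  have "path E (xs @ R) v y"
    using xs R True by (intro path_join) auto
  then have "joined True v y"
    unfolding joined_def using xs by (intro exI[of _ "xs @ R"]) auto
  then show False
    using linked_joined(2)[OF none H(1)] by blast
next
  case False
  obtain xs where xs: "path E xs v' p" "set xs \<subseteq> set os" "even (length xs) = odd (length R)"
    using odd_cycle_path_parity[OF sym_E cyc odd v(2) R(2)] False by blast
  have "path E ((xs @ R) @ [z]) v' z"
    using xs R z \<open>E y z\<close> by (intro path_snoc[OF path_join]) auto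
  then have "joined True v' z"
    unfolding joined_def using xs by (intro exI[of _ "(xs @ R) @ [z]"]) auto
  then show False
    using linked_joined(2)[OF none H(2)] by blast
qed

lemma odd_cycle_linked_eq:
  assumes none: "\<And>xs. \<not> good xs"
    and cyc: "cycle E os" "odd (length os)"
    and "x \<in> set os" "y \<in> set os" "H\<^sup>*\<^sup>* x y"
  shows "x = y"
proof (rule ccontr)
  assume "x \<noteq> y"
  then obtain xs where "path E xs x y" "even (length xs) = True"
    using odd_cycle_path_parity[OF sym_E cyc assms(4,5)] by blast
  then show False
    using linked_joined(2)[OF none assms(6)] unfolding joined_def by blast
qed

text \<open>An end of the edge that lies on the cycle must be \<open>v\<close> or \<open>v'\<close>
  itself. If an end lies off the cycle, the edge yields an ear that is excluded by
  \<open>odd_cycle_no_ear\<close>.\<close>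

lemma odd_cycle_edge_unique:
  assumes none: "\<And>xs. \<not> good xs"
    and cyc: "cycle E os" "odd (length os)"
    and v: "v \<in> set os" "v' \<in> set os" "v \<noteq> v'"
    and "E y z" and H: "H\<^sup>*\<^sup>* v y" "H\<^sup>*\<^sup>* v' z"
  shows "y = v \<and> z = v'"
proof (rule ccontr)
  assume neq: "\<not> (y = v \<and> z = v')"
  have y: "y \<in> set os \<Longrightarrow> y = v" and z: "z \<in> set os \<Longrightarrow> z = v'"
    using odd_cycle_linked_eq[OF none cyc] v H by blast+
  have neq': "y \<noteq> z"
    using \<open>E y z\<close> irrefl_E by auto
  have "E z y"
    using \<open>E y z\<close> by (rule E_sym)
  note ear = odd_cycle_no_ear[OF none cyc v _ _ _ _ _ \<open>E y z\<close> H]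
  note ear' = odd_cycle_no_ear[OF none cyc v(2,1) v(3)[symmetric] _ _ _ _ _ \<open>E z y\<close> H(2,1)]
  consider "y = v" "z \<notin> set os" | "z = v'" "y \<notin> set os" | "y \<notin> set os" "z \<notin> set os"
    using neq y z by blast
  then show False
  proof cases
    case 1
    then show False
      using ear[of v "[]"] v neq' path_singleton[of E v] by auto
  next
    case 2
    then show False
      using ear'[of v' "[]"] v neq' path_singleton[of E v'] by auto
  next
    case 3
    \<comment> \<open>With both ends off the cycle, the ear is the part of a path from
      \<open>v\<close> to \<open>y\<close> that begins at its last vertex \<open>p\<close> on the
      cycle and stops at the first of \<open>y\<close> and \<open>z\<close>. The other end of the
      edge is then not on it.\<close>
    obtain xs where xs: "path E xs v y"
      using linked_joined(1)[OF none H(1)] by (auto simp: joined_def)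
    then have "\<exists>x\<in>set xs. x \<in> set os"
      using v(1) by (auto simp: path_def intro!: bexI[of _ "hd xs"])
    then obtain as p bs where s: "xs = as @ p # bs" "p \<in> set os" "\<forall>x\<in>set bs. x \<notin> set os"
      using split_list_last_prop[of xs "\<lambda>x. x \<in> set os"] by blast
    have pbs: "path E (p # bs) p y"
      using xs s path_suffix by metis
    then have "\<exists>x\<in>set bs. x \<in> {y, z}"
      using 3 s(2) by (auto simp: path_def split: if_splits intro!: bexI[of _ "last bs"])
    then obtain cs q ds where t: "bs = cs @ q # ds" "q \<in> {y, z}" "\<forall>x\<in>set cs. x \<notin> {y, z}"
      using split_list_first_prop[of bs "\<lambda>x. x \<in> {y, z}"] by blast
    have R: "path E (p # cs @ [q]) p q"
      using pbs t path_prefix[of E "p # cs" q ds] by auto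
    have disj: "set (cs @ [q]) \<inter> set os = {}"
      using s t by auto
    show False
    proof (cases "q = y")
      case True
      then show False
        using ear[of p "cs @ [q]"] R disj s t 3 neq' by auto
    next
      case False
      then have "q = z"
        using t by auto
      then show False
        using ear'[of p "cs @ [q]"] R disj s t 3 neq' by auto
    qed
  qed
qed

end

section \<open>Dense graphs\<close>

text \<open>Adding a set to the union of \<open>k\<close> others loses at most \<open>k * s\<close>
  elements, and these losses sum to \<open>s\<close> times the binomial coefficient.\<close>

lemma card_UN_bonferroni:
  fixes N :: "'b \<Rightarrow> 'a set"
  assumes "finite I" and "\<And>x. x \<in> I \<Longrightarrow> finite (N x)" and "\<And>x. x \<in> I \<Longrightarrow> d \<le> card (N x)"
    and "\<And>x y. x \<in> I \<Longrightarrow> y \<in> I \<Longrightarrow> x \<noteq> y \<Longrightarrow> card (N x \<inter> N y) \<le> s"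
  shows "card I * d \<le> card (\<Union>(N ` I)) + s * (card I choose 2)"
  using assms
proof (induction I rule: finite_induct)
  case (insert x I)
  let ?U = "\<Union>(N ` I)"
  have fin: "finite ?U" "finite (N x)"
    using insert.hyps insert.prems(1) by simp_all
  have "card (N x \<inter> ?U) = card (\<Union>y\<in>I. N x \<inter> N y)"
    by (rule arg_cong[of _ _ card]) blast
  also have "\<dots> \<le> (\<Sum>y\<in>I. card (N x \<inter> N y))"
    using insert.hyps(1) by (rule card_UN_le)
  also have "\<dots> \<le> (\<Sum>y\<in>I. s)"
    using insert.hyps insert.prems(3) by (intro sum_mono) auto
  finally have "card (N x \<inter> ?U) \<le> card I * s"
    by simp
  moreover have "card (N x) + card ?U = card (N x \<union> ?U) + card (N x \<inter> ?U)"
    by (rule card_Un_Int[OF fin(2,1)])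
  moreover have "card I * d \<le> card ?U + s * (card I choose 2)"
    by (rule insert.IH) (use insert.prems in auto)
  moreover have "d \<le> card (N x)"
    using insert.prems(2) by simp
  moreover have "Suc (card I) choose 2 = (card I choose 2) + card I"
    by (simp add: numeral_2_eq_2)
  ultimately show ?case
    using insert.hyps by (simp add: algebra_simps)
qed simp

locale dense_graph = linked_graph +
  assumes large: "((l + 1) choose 2) * (2 * l + 1) * (3 * l - 1) < card V"
    and degree: "x \<in> V \<Longrightarrow> 2 * card V < (2 * l + 1) * card (nbrs x)"
begin

section \<open>Linked pairs and the existence of a good path\<close>

lemma H_pair_in:
  assumes "I \<subseteq> V" "card I = l + 1"
  shows "\<exists>x\<in>I. \<exists>y\<in>I. H x y"
proof (rule ccontr)
  assume none: "\<not> (\<exists>x\<in>I. \<exists>y\<in>I. H x y)"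
  \<comment> \<open>The least integer above \<open>2 * card V / (2 * l + 1)\<close>, hence a lower
    bound for all degrees.\<close>
  define d where "d = Suc (2 * card V div (2 * l + 1))"
  define b where "b = (l + 1) choose 2"
  have fin: "finite I"
    using assms(2) card.infinite by fastforce
  have d: "d \<le> card (nbrs x)" if "x \<in> I" for x
    using degree[of x] that assms(1)
    by (auto simp: d_def Suc_le_eq less_mult_imp_div_less mult.commute)
  have s: "card (nbrs x \<inter> nbrs y) \<le> 3 * l - 2" if "x \<in> I" "y \<in> I" "x \<noteq> y" for x y
  proof -
    have "card (nbrs x \<inter> nbrs y) < 3 * l - 1"
      using none that by (auto simp: H_def not_le)
    then show ?thesis
      by linarith
  qed
  have "card I * d \<le> card (\<Union>(nbrs ` I)) + (3 * l - 2) * (card I choose 2)"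
    using card_UN_bonferroni[OF fin finite_nbrs d s] .
  also have "card (\<Union>(nbrs ` I)) \<le> card V"
    using finite_V E_in_V E_sym by (intro card_mono) (auto simp: nbrs_def)
  finally have 1: "(l + 1) * d \<le> card V + (3 * l - 2) * b"
    using assms(2) by (simp add: b_def)
  have 2: "2 * card V < (2 * l + 1) * d"
    unfolding d_def by (metis dividend_less_times_div mult_Suc_right add.commute zero_less_Suc Suc_eq_plus1)
  have "(l + 1) * (2 * card V) \<le> (2 * l + 1) * ((l + 1) * d)"
    using mult_le_mono[OF le_refl less_imp_le[OF 2], of "l + 1"] by (simp only: ac_simps)
  also have "\<dots> \<le> (2 * l + 1) * (card V + (3 * l - 2) * b)"
    using 1 by (rule mult_le_mono[OF le_refl])
  \<comment> \<open>Since \<open>2 * (l + 1) - (2 * l + 1) = 1\<close>, exactly one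
    \<open>card V\<close> survives the cancellation.\<close>
  finally have "card V \<le> (2 * l + 1) * ((3 * l - 2) * b)"
    by (simp add: algebra_simps)
  also have "\<dots> \<le> (2 * l + 1) * ((3 * l - 1) * b)"
    by (intro mult_le_mono) auto
  finally show False
    using large by (simp only: b_def ac_simps not_less[symmetric])
qed

text \<open>A maximal pairwise unlinked set works: each vertex outside is linked to a member, and
  \<open>l + 1\<close> members would contain a linked pair. The reflexive closure covers the members
  themselves.\<close>

lemma dominating_set:
  "\<exists>I\<subseteq>V. card I \<le> l \<and> (\<forall>x\<in>V. \<exists>i\<in>I. H\<^sup>*\<^sup>* x i)"
proof -
  let ?S = "{I. I \<subseteq> V \<and> (\<forall>x\<in>I. \<forall>y\<in>I. \<not> H x y)}"
  have "finite ?S"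
    using finite_V by (intro finite_subset[of ?S "Pow V"]) auto
  moreover have "{} \<in> ?S"
    by auto
  ultimately obtain I where I: "I \<in> ?S" "\<And>J. J \<in> ?S \<Longrightarrow> I \<subseteq> J \<Longrightarrow> J = I"
    using finite_has_maximal[of ?S] by (metis (lifting) empty_iff)
  have "\<exists>i\<in>I. H\<^sup>*\<^sup>* x i" if "x \<in> V" for x
  proof (rule ccontr)
    assume neg: "\<not> (\<exists>i\<in>I. H\<^sup>*\<^sup>* x i)"
    then have "x \<notin> I" "\<forall>i\<in>I. \<not> H x i"
      by auto
    moreover have "\<not> H x x"
      by (simp add: H_def)
    ultimately have "insert x I \<in> ?S"
      using I(1) that H_sym by blast
    then show False
      using I(2) \<open>x \<notin> I\<close> by blast
  qed
  moreover have "card I \<le> l"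
  proof (rule ccontr)
    assume "\<not> card I \<le> l"
    then have "l + 1 \<le> card I"
      by simp
    then obtain J where J: "J \<subseteq> I" "card J = l + 1"
      by (rule obtain_subset_with_card_n)
    then show False
      using H_pair_in[of J] I(1) by blast
  qed
  ultimately show ?thesis
    using I(1) by blast
qed

lemma good_exists:
  assumes robust: "\<And>F. F \<subseteq> {{x, y} | x y. E x y} \<Longrightarrow> card F \<le> l ^ 3 \<Longrightarrow>
    \<exists>os. cycle (\<lambda>x y. E x y \<and> {x, y} \<notin> F) os \<and> odd (length os)"
  shows "\<exists>xs. good xs"
proof (rule ccontr)
  assume "\<not> (\<exists>xs. good xs)"
  then have none: "\<not> good xs" for xs
    by blast
  obtain I where I: "I \<subseteq> V" "card I \<le> l" "\<And>x. x \<in> V \<Longrightarrow> \<exists>i\<in>I. H\<^sup>*\<^sup>* x i"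
    using dominating_set by blast
  then obtain r where r: "\<And>x. x \<in> V \<Longrightarrow> r x \<in> I \<and> H\<^sup>*\<^sup>* x (r x)"
    by metis
  define M where "M = {{x, y} | x y. E x y}"
  \<comment> \<open>The edges that are alone between their two classes. On them
    \<open>image r\<close> is injective, so they are at most as many as the ordered pairs from
    \<open>I\<close>.\<close>
  define F where "F = {e \<in> M. \<forall>e'\<in>M. r ` e' = r ` e \<longrightarrow> e' = e}"
  have "finite I"
    using I(1) finite_V finite_subset by blast
  have "r ` e \<in> (\<lambda>(a, b). {a, b}) ` (I \<times> I)" if "e \<in> F" for e
  proof -
    obtain x y where "e = {x, y}" "E x y"
      using \<open>e \<in> F\<close> by (auto simp: F_def M_def)
    moreover from this have "r x \<in> I" "r y \<in> I"
      using r E_in_V E_sym by blast+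
    ultimately show ?thesis
      by (intro image_eqI[of _ _ "(r x, r y)"]) auto
  qed
  then have "card (image r ` F) \<le> card ((\<lambda>(a, b). {a, b}) ` (I \<times> I))"
    using \<open>finite I\<close> by (intro card_mono) auto
  also have "\<dots> \<le> card I * card I"
    using \<open>finite I\<close> by (metis card_cartesian_product card_image_le finite_SigmaI)
  also have "\<dots> \<le> l * l"
    using I(2) by (rule mult_le_mono[OF _ I(2)])
  also have "\<dots> \<le> l ^ 3"
    using l_ge_2 by (simp add: power3_eq_cube)
  also have "card (image r ` F) = card F"
    by (intro card_image inj_onI) (auto simp: F_def)
  finally have "card F \<le> l ^ 3" .
  moreover have "F \<subseteq> M"
    by (auto simp: F_def)
  ultimately obtain os where os: "cycle (\<lambda>x y. E x y \<and> {x, y} \<notin> F) os" and odd: "odd (length os)"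
    using robust unfolding M_def by blast
  have cyc: "cycle E os"
    using os by (auto simp: cycle_def elim!: successively_mono)
  \<comment> \<open>Any edge of the cycle would do; the closing edge is directly accessible. It
    survived the deletion, so a second edge joins the same classes.\<close>
  let ?v = "last os" and ?v' = "hd os"
  have v: "E ?v ?v'" "{?v, ?v'} \<notin> F" and set: "?v \<in> set os" "?v' \<in> set os"
    using os by (auto simp: cycle_def)
  have "?v \<noteq> ?v'"
    using v(1) by (rule E_neq)
  have "{?v, ?v'} \<in> M"
    using v by (auto simp: M_def)
  then obtain e where e: "e \<in> M" "r ` e = r ` {?v, ?v'}" "e \<noteq> {?v, ?v'}"
    using v(2) by (auto simp: F_def)
  obtain y z where yz: "E y z" "e = {y, z}"
    using e(1) by (auto simp: M_def)
  have class_eq: "H\<^sup>*\<^sup>* x y" if "x \<in> V" "y \<in> V" "r x = r y" for x y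
    using r that by (metis rtranclp_trans symp_H symp_rtranclp sympD)
  have V: "y \<in> V" "z \<in> V" "?v \<in> V" "?v' \<in> V"
    using yz v E_in_V E_sym by blast+
  have "(r y = r ?v \<and> r z = r ?v') \<or> (r z = r ?v \<and> r y = r ?v')"
    using e(2) yz(2) by (auto simp: doubleton_eq_iff)
  then show False
  proof
    assume "r y = r ?v \<and> r z = r ?v'"
    then show False
      using odd_cycle_edge_unique[OF none cyc odd set \<open>?v \<noteq> ?v'\<close> yz(1)] class_eq V e yz by metis
  next
    assume "r z = r ?v \<and> r y = r ?v'"
    then show False
      using odd_cycle_edge_unique[OF none cyc odd set \<open>?v \<noteq> ?v'\<close> E_sym[OF yz(1)]] class_eq V e yz
      by (metis insert_commute)
  qed
qed

section \<open>Lengthening good paths and closing them up\<close>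

lemma good_extend:
  assumes "good xs" "length xs + 4 \<le> 2 * l"
  shows "\<exists>ys. good ys \<and> length ys = length xs + 2"
proof -
  let ?x = "hd xs" and ?y = "last xs"
  let ?W = "nbrs ?x \<inter> nbrs ?y - set xs"
  have "3 * l - 1 \<le> card (nbrs ?x \<inter> nbrs ?y)"
    using assms(1) by (simp add: good_def H_def)
  also have "\<dots> \<le> card ?W + card (set xs)"
    by (metis card_Un_le Un_Diff_cancel2 card_mono finite_Diff finite_Int finite_UnI finite_nbrs
        List.finite_set order_trans Un_upper1)
  also have "\<dots> \<le> card ?W + length xs"
    using card_length by auto
  finally have "l + 1 \<le> card ?W"
    using assms(2) by linarith
  then obtain I where I: "I \<subseteq> ?W" "card I = l + 1"
    by (rule obtain_subset_with_card_n)
  moreover have "?W \<subseteq> V"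
    using E_in_V E_sym by (auto simp: nbrs_def)
  ultimately obtain c c' where c: "c \<in> ?W" "c' \<in> ?W" "H c c'"
    using H_pair_in[of I] by blast
  have "path E (c # xs) c ?y"
    using assms(1) c by (intro path_Cons) (auto simp: good_def nbrs_def E_sym)
  then have "path E ((c # xs) @ [c']) c c'"
    using c by (intro path_snoc) (auto simp: nbrs_def H_def)
  then have "good (c # xs @ [c'])"
    using assms(1) c(3) by (intro goodI[of _ c c']) (auto simp: good_def)
  then show ?thesis
    by (intro exI[of _ "c # xs @ [c']"]) auto
qed

lemma good_closes_up:
  assumes "good xs" "length xs + 2 \<le> 2 * l"
  shows "\<exists>os. cycle E os \<and> length os = 2 * l - 1"
  using assms
proof (induction "2 * l - length xs" arbitrary: xs rule: less_induct)
  case less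
  have even: "even (length xs)" "xs \<noteq> []"
    using less.prems by (auto simp: good_def path_def)
  show ?case
  proof (cases "length xs + 4 \<le> 2 * l")
    case True
    then obtain ys where "good ys" "length ys = length xs + 2"
      using good_extend less.prems by blast
    then show ?thesis
      using less.hyps[of ys] True by auto
  next
    case False
    \<comment> \<open>The number of vertices is even, more than \<open>2 * l - 4\<close> and at most
      \<open>2 * l - 2\<close>.\<close>
    then have len: "length xs + 2 = 2 * l"
      using less.prems(2) even by presburger
    have "card (set xs) < 3 * l - 1"
      using card_length[of xs] len l_ge_2 by linarith
    moreover have "H (hd xs) (last xs)"
      using less.prems by (simp add: good_def)
    ultimately obtain w where w: "E (hd xs) w" "E (last xs) w" "w \<notin> set xs"
      using H_common_nbr[OF _ List.finite_set] by metis
    then have "cycle E (w # xs)"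
      using less.prems even by (auto simp: good_def path_def cycle_def successively_Cons E_sym)
    then show ?thesis
      using len by (intro exI[of _ "w # xs"]) auto
  qed
qed

text \<open>If the common neighbour \<open>w\<close> lay on the path, one of the shortcuts from an
  end of the path to \<open>w\<close> would give a path of even order between the same ends. It is
  shorter unless \<open>w\<close> is the second or the last but one vertex, so these two are avoided
  in the choice of \<open>w\<close>.\<close>

lemma minimal_good_cycle:
  assumes "good xs" and min: "\<And>ys. good ys \<Longrightarrow> length xs \<le> length ys"
  shows "\<exists>w. cycle E (w # xs)"
proof -
  let ?x = "hd xs" and ?y = "last xs"
  have path: "path E xs ?x ?y" and even: "even (length xs)" and H: "H ?x ?y" and ne: "xs \<noteq> []"
    using assms(1) by (auto simp: good_def path_def)
  have "card {xs ! 1, xs ! (length xs - 2)} < 3 * l - 1"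
    using l_ge_2 card_insert_le_m1[of 2 "{xs ! (length xs - 2)}" "xs ! 1"] by auto
  then obtain w where w: "E ?x w" "E ?y w" "w \<notin> {xs ! 1, xs ! (length xs - 2)}"
    by (rule H_common_nbr[OF H finite.insertI[OF finite.insertI[OF finite.emptyI]]])
  have "w \<notin> set xs"
  proof
    assume "w \<in> set xs"
    then obtain as bs where xs: "xs = as @ w # bs"
      by (meson split_list)
    have nth: "xs ! length as = w"
      using xs by simp
    have bs: "bs \<noteq> []" and as: "as \<noteq> []"
      using w irrefl_E xs by auto
    show False
    proof (cases "even (length as)")
      case True
      have "?y \<in> set bs"
        using xs bs by auto
      then have "?y \<notin> set (as @ [w])"
        using path xs by (auto simp: path_def)
      then have "path E ((as @ [w]) @ [?y]) ?x ?y"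
        using path xs w by (intro path_snoc[OF path_prefix[of E as w bs ?x ?y]]) (auto simp: E_sym)
      then have "length xs \<le> length ((as @ [w]) @ [?y])"
        using True by (intro min goodI[OF _ _ H]) auto
      then have "length bs = 1"
        using xs bs by (cases bs) auto
      then have "length as = length xs - 2"
        using xs by simp
      then show False
        using nth w by auto
    next
      case False
      have "?x \<in> set as"
        using xs as by (cases as) auto
      then have "?x \<notin> set (w # bs)"
        using path xs by (auto simp: path_def)
      then have "path E (?x # w # bs) ?x ?y"
        using path xs w by (intro path_Cons[OF path_suffix[of E as w bs ?x ?y]]) auto
      then have "length xs \<le> length (?x # w # bs)"
        using False even xs by (intro min goodI[OF _ _ H]) auto
      then have "length as = 1"
        using xs as by (cases as) auto
      then show False
        using nth w by auto
    qed
  qed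
  then show ?thesis
    using path w ne by (auto simp: path_def cycle_def successively_Cons E_sym)
qed

end

text \<open>The indices \<open>0, 1, 4, 5, 8, 9, \<dots>\<close>: no two of them differ by 2, so two of the first
  \<open>l + 1\<close> are at distance 2 on a cycle of length at least \<open>2 * l + 1\<close> only by wrapping around.\<close>

definition spread :: "nat \<Rightarrow> nat" where
  "spread j = 4 * (j div 2) + j mod 2"

lemma spread_cases:
  obtains c where "j = 2 * c" "spread j = 4 * c" | c where "j = 2 * c + 1" "spread j = 4 * c + 1"
  by (cases "even j") (auto simp: spread_def elim!: evenE oddE)

lemma spread_le: "spread j \<le> 2 * j"
  by (cases j rule: spread_cases) auto

lemma spread_less: "i < j \<Longrightarrow> spread i < spread j"
  by (cases i rule: spread_cases; cases j rule: spread_cases) auto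

lemma spread_not_add_2: "spread j \<noteq> spread i + 2"
  by (cases i rule: spread_cases; cases j rule: spread_cases; presburger)

text \<open>From \<open>spread j \<le> 2 * j\<close> follows \<open>j = l\<close>, and
  \<open>spread l\<close> is \<open>2 * l\<close> for even \<open>l\<close> and
  \<open>2 * l - 1\<close> for odd \<open>l\<close>.\<close>

lemma spread_wrap:
  assumes "spread j + 1 = spread i + 2 * l" "j \<le> l"
  shows "spread i = (if even l then 1 else 0)"
proof -
  have *: "spread j \<le> 2 * l"
    using spread_le[of j] assms(2) by linarith
  show ?thesis
    using assms * by (cases i rule: spread_cases; cases j rule: spread_cases; simp; presburger)
qed

text \<open>The cycle made of a shortest good path and a common neighbour of its ends. Only the
  length bound on good paths is kept, so all positions on the cycle are alike.\<close>

locale minimal_cycle = dense_graph +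
  fixes os :: "'a list"
  assumes cyc: "cycle E os" and odd_length: "odd (length os)"
    and minimal: "\<And>xs. good xs \<Longrightarrow> length os \<le> length xs + 1"
begin

abbreviation v :: "nat \<Rightarrow> 'a" where
  "v \<equiv> cyc_nth os"

lemma v_in_os: "v i \<in> set os"
  using cyc by (auto simp: cyc_nth_def cycle_def)

lemma v_in_V: "v i \<in> V"
  using cyc_nth_step[OF cyc] E_in_V by blast

text \<open>One of the two arcs between the vertices has an even number of vertices and is therefore
  good. By minimality it misses at most one vertex of the cycle, so the other arc has two
  edges.\<close>

lemma H_cyclic_distance:
  assumes "H (v i) (v (i + k))" "k < length os"
  shows "k = 2 \<or> k + 2 = length os"
proof -
  have "k \<noteq> 0"
    using assms(1) by (auto simp: H_def intro!: Nat.gr0I)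
  show ?thesis
  proof (cases "odd k")
    case True
    have "good (map v [i..<Suc (i + k)])"
      using goodI[OF cycle_arc[OF cyc assms(2)] _ assms(1)] True by simp
    from minimal[OF this] have "length os \<le> k + 2"
      by simp
    then show ?thesis
      using assms(2) True odd_length by presburger
  next
    case False
    have "path E (map v [i + k..<Suc (i + k + (length os - k))]) (v (i + k)) (v (i + k + (length os - k)))"
      using \<open>k \<noteq> 0\<close> assms(2) by (intro cycle_arc[OF cyc]) auto
    moreover have "H (v (i + k)) (v (i + k + (length os - k)))"
      using assms H_sym cyc_nth_add_length[of os i] by simp
    moreover have "even (length (map v [i + k..<Suc (i + k + (length os - k))]))"
      using False odd_length assms(2) by simp
    ultimately have "length os \<le> length (map v [i + k..<Suc (i + k + (length os - k))]) + 1"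
      by (intro minimal goodI)
    then show ?thesis
      using \<open>k \<noteq> 0\<close> False assms(2) by auto
  qed
qed

text \<open>Among the \<open>l + 1\<close> positions \<open>i + spread j\<close> there is a linked
  pair, at cyclic distance 2 and hence across the wrap. This forces the length, and by
  \<open>spread_wrap\<close> the place of the pair; as \<open>i\<close> is arbitrary, every pair at
  distance 2 can be reached.\<close>

lemma wrapping_H_pair:
  assumes "2 * l + 1 \<le> length os"
  shows "length os = 2 * l + 1"
    and "H (v (i + (if even l then 1 else 0))) (v (i + (if even l then 1 else 0) + (length os - 2)))"
proof -
  have less: "spread j < length os" if "j \<le> l" for j
    using spread_le[of j] that assms by linarith
  have inj: "j = j'" if "spread j = spread j'" for j j'
    using spread_less that by (metis less_irrefl linorder_neqE_nat)
  define I where "I = (\<lambda>j. v (i + spread j)) ` {..l}"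
  have "inj_on (\<lambda>j. v (i + spread j)) {..l}"
  proof (rule inj_onI)
    fix j j'
    assume "j \<in> {..l}" "j' \<in> {..l}" "v (i + spread j) = v (i + spread j')"
    then show "j = j'"
      using cyc_nth_eq_iff[of os "spread j" "spread j'" i] less inj cyc by (auto simp: cycle_def)
  qed
  then have "card I = l + 1"
    by (simp add: I_def card_image)
  moreover have "I \<subseteq> V"
    using v_in_V by (auto simp: I_def)
  ultimately obtain x y where "x \<in> I" "y \<in> I" "H x y"
    using H_pair_in by blast
  then obtain a b where ab: "a \<le> l" "b \<le> l" "H (v (i + spread a)) (v (i + spread b))"
    by (auto simp: I_def)
  then have "a \<noteq> b"
    by (auto simp: H_def)
  then obtain a b where ab: "a < b" "b \<le> l" "H (v (i + spread a)) (v (i + spread b))"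
    using ab H_sym by (meson linorder_neqE_nat)
  define k where "k = spread b - spread a"
  have bk: "spread b = spread a + k"
    using spread_less[OF ab(1)] unfolding k_def by simp
  have H: "H (v (i + spread a)) (v (i + spread a + k))"
    using ab(3) bk by (simp add: add.assoc)
  have "k \<noteq> 2"
    using bk spread_not_add_2 by metis
  moreover have "k < length os"
    using bk less[OF ab(2)] by simp
  ultimately have k: "k + 2 = length os"
    using H_cyclic_distance[OF H] by blast
  show L: "length os = 2 * l + 1"
    using k bk ab(2) assms odd_length spread_le[of b] by presburger
  have "spread a = (if even l then 1 else 0)"
    using k bk ab(2) L by (intro spread_wrap) auto
  then show "H (v (i + (if even l then 1 else 0))) (v (i + (if even l then 1 else 0) + (length os - 2)))"
    using H k by (metis diff_add_inverse2)
qed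

lemma length_bound: "length os \<le> 2 * l + 1"
  using wrapping_H_pair(1) by linarith

section \<open>The extremal length \<open>2 * l + 1\<close>\<close>

lemma tight_H:
  assumes "length os = 2 * l + 1"
  shows "H (v i) (v (i + 2))"
proof -
  let ?c = "if even l then 1 else 0 :: nat"
  \<comment> \<open>Shifted so that the wrapping pair starts at \<open>i + 2\<close> and ends at
    \<open>i + length os\<close>, which is the vertex \<open>v i\<close>.\<close>
  have "H (v (i + 2 - ?c + ?c)) (v (i + 2 - ?c + ?c + (length os - 2)))"
    using wrapping_H_pair(2)[of "i + 2 - ?c"] assms by simp
  moreover have "i + 2 - ?c + ?c = i + 2" "i + 2 + (length os - 2) = i + length os"
    using assms l_ge_2 by auto
  ultimately show ?thesis
    using H_sym cyc_nth_add_length by metis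
qed

text \<open>The ends \<open>v (i + 2)\<close> and \<open>v i\<close> are linked in the tight case.
  This arc becomes a good path when a chord or an outside vertex leads from \<open>v (i + k)\<close>
  back to \<open>v i\<close>.\<close>

lemma arc_skip:
  assumes "2 \<le> k" "k < length os"
  obtains xs where "path E xs (v (i + 2)) (v (i + k))" "v i \<notin> set xs" "set xs \<subseteq> set os" "length xs = k - 1"
proof
  let ?xs = "map v [i + 2..<Suc (i + 2 + (k - 2))]"
  have *: "i + 2 + (k - 2) = i + k"
    using assms(1) by simp
  show "path E ?xs (v (i + 2)) (v (i + k))"
    using cycle_arc[OF cyc, of "k - 2" "i + 2"] assms(2) unfolding * by simp
  show "v i \<notin> set ?xs"
  proof
    assume "v i \<in> set ?xs"
    then obtain m where "m \<in> {i + 2..<Suc (i + 2 + (k - 2))}" "v i = v m"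
      unfolding set_map set_upt by blast
    moreover from this have "m - i < length os"
      using assms by auto
    ultimately show False
      using cyc_nth_eq_iff[of os 0 "m - i" i] cyc assms by (auto simp: cycle_def)
  qed
  show "set ?xs \<subseteq> set os"
    using v_in_os by auto
  show "length ?xs = k - 1"
    using assms(1) unfolding * by (simp del: upt_Suc)
qed

text \<open>A chord with even \<open>k < 2 * l\<close> closes the skipped arc to a good path on
  \<open>k\<close> vertices, too few for minimality. For odd \<open>k\<close> the other side of the
  chord spans an even number of edges.\<close>

lemma tight_chord:
  assumes L: "length os = 2 * l + 1" and "E (v i) (v (i + k))" "k < length os"
  shows "k = 1 \<or> k = 2 * l"
proof -
  have even_chord: "k = 2 * l" if chord: "E (v i) (v (i + k))" "k < length os" "even k" for i k
  proof (rule ccontr)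
    assume "k \<noteq> 2 * l"
    have "k \<noteq> 0"
      using chord(1) irrefl_E by (cases k) auto
    then have k: "2 \<le> k" "k < 2 * l"
      using chord L \<open>k \<noteq> 2 * l\<close> by presburger+
    then obtain xs where xs: "path E xs (v (i + 2)) (v (i + k))" "v i \<notin> set xs" "length xs = k - 1"
      using arc_skip[of k i] chord(2) by metis
    then have "path E (xs @ [v i]) (v (i + 2)) (v i)"
      using chord(1) by (intro path_snoc[OF xs(1)]) (auto simp: E_sym)
    then have "good (xs @ [v i])"
      using k chord(3) xs(3) H_sym[OF tight_H[OF L]] by (intro goodI) auto
    from minimal[OF this] show False
      using k L xs(3) by simp
  qed
  show ?thesis
  proof (cases "even k")
    case True
    then show ?thesis
      using even_chord assms by blast
  next
    case False
    then have "0 < k"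
      by (rule odd_pos)
    then have "length os - k = 2 * l"
      using False assms cyc_nth_add_length[of os i] by (intro even_chord[of "i + k"]) (auto simp: E_sym)
    then show ?thesis
      using L assms(3) by auto
  qed
qed

text \<open>For odd \<open>k \<ge> 3\<close> the arc followed by \<open>u\<close> and
  \<open>v i\<close> is a good path on \<open>k + 1\<close> vertices, so
  \<open>k \<ge> 2 * l - 1\<close>. Even \<open>k\<close> is the same seen from the other
  side.\<close>

lemma tight_outside:
  assumes L: "length os = 2 * l + 1" and u: "u \<notin> set os"
    and "E u (v i)" "E u (v (i + k))" "0 < k" "k < length os"
  shows "k \<in> {1, 2, 2 * l - 1, 2 * l}"
proof -
  have odd_gap: "k = 1 \<or> k = 2 * l - 1" if gap: "E u (v i)" "E u (v (i + k))" "k < length os" "odd k" for i k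
  proof (rule ccontr)
    assume neq: "\<not> (k = 1 \<or> k = 2 * l - 1)"
    have k: "3 \<le> k" "k + 3 \<le> 2 * l"
      using gap neq L by presburger+
    then obtain xs where xs: "path E xs (v (i + 2)) (v (i + k))" "v i \<notin> set xs" "set xs \<subseteq> set os"
      "length xs = k - 1"
      using arc_skip[of k i] gap(3) by (metis Suc_leD numeral_3_eq_3 numeral_2_eq_2)
    have "path E (xs @ [u]) (v (i + 2)) u"
      using gap u xs by (intro path_snoc[OF xs(1)]) (auto simp: E_sym)
    then have "path E ((xs @ [u]) @ [v i]) (v (i + 2)) (v i)"
      using gap xs(2) E_neq[OF gap(1)] by (intro path_snoc) auto
    then have "good ((xs @ [u]) @ [v i])"
      using k gap(4) xs(4) H_sym[OF tight_H[OF L]] by (intro goodI) auto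
    from minimal[OF this] show False
      using k L xs(4) by simp
  qed
  show ?thesis
  proof (cases "odd k")
    case True
    then show ?thesis
      using odd_gap assms by blast
  next
    case False
    then have "length os - k = 1 \<or> length os - k = 2 * l - 1"
      using assms cyc_nth_add_length[of os i] by (intro odd_gap[of "i + k"]) auto
    then show ?thesis
      using L assms(6) by auto
  qed
qed

text \<open>For \<open>l = 2\<close> the triangle is itself the excluded cycle. For
  \<open>l \<ge> 3\<close> a third consecutive neighbour gives a good path on four vertices, fewer
  than the \<open>2 * l\<close> required.\<close>

lemma tight_no_edge_triangle:
  assumes L: "length os = 2 * l + 1" and no_cycle: "\<And>xs. cycle E xs \<Longrightarrow> length xs \<noteq> 2 * l - 1"
    and u: "u \<notin> set os" and "E u (v i)" "E u (v (i + 1))"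
  shows "l \<ge> 3" and "\<not> E u (v (i + 2))"
proof -
  have step: "E (v j) (v (Suc j))" for j
    using cyc_nth_step[OF cyc] .
  show l: "l \<ge> 3"
  proof (rule ccontr)
    assume "\<not> l \<ge> 3"
    then have "l = 2"
      using l_ge_2 by simp
    moreover have "cycle E [u, v i, v (i + 1)]"
      using assms(4,5) step[of i] E_sym E_neq by (auto simp: cycle_def)
    ultimately show False
      using no_cycle by fastforce
  qed
  show "\<not> E u (v (i + 2))"
  proof
    assume "E u (v (i + 2))"
    have "v i \<noteq> v (i + 2)" "v (i + 1) \<noteq> v (i + 2)"
      using cyc_nth_eq_iff[of os 0 2 i] cyc_nth_eq_iff[of os 1 2 i] cyc L l by (auto simp: cycle_def)
    then have "path E [v i, v (i + 1), u, v (i + 2)] (v i) (v (i + 2))"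
      using step[of i] step[of "i + 1"] assms(4,5) \<open>E u (v (i + 2))\<close> E_neq E_sym
      by (auto simp: path_def)
    then have "good [v i, v (i + 1), u, v (i + 2)]"
      using tight_H[OF L] by (intro goodI) auto
    from minimal[OF this] show False
      using L l by simp
  qed
qed

lemma tight_few_nbrs:
  assumes L: "length os = 2 * l + 1" and no_cycle: "\<And>xs. cycle E xs \<Longrightarrow> length xs \<noteq> 2 * l - 1"
  shows "card {i. i < length os \<and> E u (v i)} \<le> 2"
proof (cases "u \<in> set os")
  case True
  then obtain j where j: "j < length os" "u = v j"
    by (auto simp: in_set_conv_nth cyc_nth_def)
  have "i \<in> {(j + 1) mod length os, (j + 2 * l) mod length os}" if i: "i < length os" "E u (v i)" for i
  proof (cases "j \<le> i")
    case True
    then have "i - j = 1 \<or> i - j = 2 * l"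
      using tight_chord[OF L, of j "i - j"] i j by auto
    then show ?thesis
      using True i by (metis insertCI le_add_diff_inverse mod_less)
  next
    case False
    then have "i + length os - j = 1 \<or> i + length os - j = 2 * l"
      using tight_chord[OF L, of j "i + length os - j"] i j cyc_nth_add_length[of os i] by auto
    then have "j + 1 = i + length os \<or> j + 2 * l = i + length os"
      using False j by linarith
    then show ?thesis
      using i(1) by (metis insertCI mod_add_self2 mod_less)
  qed
  then have "{i. i < length os \<and> E u (v i)} \<subseteq> {(j + 1) mod length os, (j + 2 * l) mod length os}"
    by blast
  then have "card {i. i < length os \<and> E u (v i)} \<le> card {(j + 1) mod length os, (j + 2 * l) mod length os}"
    by (intro card_mono) auto
  also have "\<dots> \<le> 2"
    by (simp add: card_insert_if)
  finally show ?thesis .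
next
  case u: False
  let ?S = "{i. i < length os \<and> E u (v i)}"
  have gap: "j - i \<in> {1, 2, 2 * l - 1, 2 * l}" if "i \<in> ?S" "j \<in> ?S" "i < j" for i j
    using tight_outside[OF L u, of i "j - i"] that by auto
  note tri = tight_no_edge_triangle[OF L no_cycle u]
  have wrap: "v (2 * l + 1) = v 0" "v (2 * l + 2) = v 1"
    using cyc_nth_add_length[of os 0] cyc_nth_add_length[of os 1] L by auto
  show ?thesis
  proof (rule ccontr)
    assume "\<not> ?thesis"
    then have "3 \<le> card ?S"
      by simp
    then obtain T where T: "T \<subseteq> ?S" "card T = 3" "finite T"
      by (rule obtain_subset_with_card_n)
    then obtain a b c where abc: "a \<in> ?S" "b \<in> ?S" "c \<in> ?S" "a \<noteq> b" "b \<noteq> c" "a \<noteq> c"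
      by (auto simp: card_3_iff)
    then obtain p q r where S: "p \<in> ?S" "q \<in> ?S" "r \<in> ?S" and pqr: "p < q" "q < r"
      by (meson linorder_neqE_nat)
    have gaps: "q - p \<in> {1, 2, 2 * l - 1, 2 * l}" "r - q \<in> {1, 2, 2 * l - 1, 2 * l}" "r - p \<in> {1, 2, 2 * l - 1, 2 * l}"
      using gap S pqr by auto
    have r: "r \<le> 2 * l"
      using S L by auto
    have l: "l \<ge> 3"
    proof (rule ccontr)
      assume "\<not> l \<ge> 3"
      then have l: "l = 2"
        using l_ge_2 by simp
      \<comment> \<open>Of three positions on a 5-cycle, two are adjacent.\<close>
      have "q = p + 1 \<or> r = q + 1 \<or> p = 0 \<and> r = 2 * l"
        using l pqr r by linarith
      then show False
        using tri(1)[of p] tri(1)[of q] tri(1)[of "2 * l"] S wrap \<open>\<not> l \<ge> 3\<close> by auto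
    qed
    \<comment> \<open>On a cycle of length at least 7, three positions pairwise within distance 2
      are consecutive. The cases differ in where the wrap falls.\<close>
    have "(q = p + 1 \<and> r = p + 2) \<or> (p = 0 \<and> q = 1 \<and> r = 2 * l) \<or> (p = 0 \<and> q = 2 * l - 1 \<and> r = 2 * l)"
    proof -
      have "q \<le> p + 2 \<or> p + 2 * l \<le> q + 1" "r \<le> q + 2 \<or> q + 2 * l \<le> r + 1" "r \<le> p + 2 \<or> p + 2 * l \<le> r + 1"
        using gaps by auto
      moreover have ?thesis if "q \<le> p + 2" "r \<le> q + 2" "r \<le> p + 2"
        using that pqr by linarith
      moreover have ?thesis if "p + 2 * l \<le> q + 1"
        using that pqr r l by linarith
      moreover have ?thesis if "q + 2 * l \<le> r + 1"
        using that pqr r l by linarith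
      moreover have False if "q \<le> p + 2" "r \<le> q + 2" "p + 2 * l \<le> r + 1"
        using that l by linarith
      ultimately show ?thesis
        by blast
    qed
    then show False
    proof (elim disjE)
      assume "q = p + 1 \<and> r = p + 2"
      then show False
        using tri(2)[of p] S by auto
    next
      assume "p = 0 \<and> q = 1 \<and> r = 2 * l"
      then show False
        using tri(2)[of "2 * l"] S wrap by auto
    next
      assume "p = 0 \<and> q = 2 * l - 1 \<and> r = 2 * l"
      then show False
        using tri(2)[of "2 * l - 1"] S wrap l by (auto simp: Suc_diff_le)
    qed
  qed
qed

text \<open>Double counting of the pairs of a cycle position and a neighbour of its vertex: the
  degrees give more than \<open>2 * card V\<close>, the bound of two per vertex at most
  that.\<close>

lemma not_tight:
  assumes no_cycle: "\<And>xs. cycle E xs \<Longrightarrow> length xs \<noteq> 2 * l - 1"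
  shows "length os \<noteq> 2 * l + 1"
proof
  assume L: "length os = 2 * l + 1"
  have nbrs: "nbrs (v i) = {u \<in> V. E u (v i)}" for i
    using E_in_V E_sym by (auto simp: nbrs_def)
  define d where "d = Suc (2 * card V div (2 * l + 1))"
  have d: "d \<le> card (nbrs (v i))" for i
    using degree[OF v_in_V[of i]]
    by (auto simp: d_def Suc_le_eq less_mult_imp_div_less mult.commute)
  have "(2 * l + 1) * d = (\<Sum>i<length os. d)"
    using L by simp
  also have "\<dots> \<le> (\<Sum>i<length os. card (nbrs (v i)))"
    by (intro sum_mono d)
  also have "\<dots> = (\<Sum>i<length os. \<Sum>u\<in>V. if E u (v i) then 1 else 0)"
    using finite_V by (simp add: nbrs sum.If_cases Int_def)
  also have "\<dots> = (\<Sum>u\<in>V. \<Sum>i<length os. if E u (v i) then 1 else 0)"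
    by (rule sum.swap)
  also have "\<dots> = (\<Sum>u\<in>V. card {i. i < length os \<and> E u (v i)})"
    by (simp add: sum.If_cases Int_def)
  also have "\<dots> \<le> (\<Sum>u\<in>V. 2)"
    by (intro sum_mono tight_few_nbrs[OF L no_cycle])
  finally have "(2 * l + 1) * d \<le> 2 * card V"
    by simp
  moreover have "2 * card V < (2 * l + 1) * d"
    unfolding d_def by (metis dividend_less_times_div mult_Suc_right add.commute zero_less_Suc Suc_eq_plus1)
  ultimately show False
    by simp
qed

end

context dense_graph
begin

lemma cycle_of_good:
  assumes "good xs"
  shows "\<exists>os. cycle E os \<and> length os = 2 * l - 1"
proof (rule ccontr)
  assume none: "\<not> ?thesis"
  obtain ys where ys: "good ys" "\<And>zs. good zs \<Longrightarrow> length ys \<le> length zs"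
    using assms exists_least_iff[of "\<lambda>k. \<exists>xs. good xs \<and> length xs = k"] by (metis not_less)
  obtain w where w: "cycle E (w # ys)"
    using minimal_good_cycle[OF ys] by blast
  interpret minimal_cycle V E l "w # ys"
  proof
    show "odd (length (w # ys))"
      using ys(1) by (simp add: good_def)
  qed (use w ys in auto)
  have "length (w # ys) \<noteq> 2 * l + 1"
    using not_tight none by blast
  \<comment> \<open>The cycle is odd, so below \<open>2 * l + 1\<close> its length is at most
    \<open>2 * l - 1\<close>.\<close>
  then have "length ys + 2 \<le> 2 * l"
    using length_bound ys(1) odd_length by simp presburger
  then show False
    using good_closes_up[OF ys(1)] none by blast
qed

end

section \<open>Translation to the graphs of the theorem\<close>

lemma degree_eq_card_nbrs:
  assumes "simple_graph G"
  shows "degree G x = card {y. {x, y} \<in> edges G}"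
proof -
  have "{e \<in> edges G. x \<in> e} = (\<lambda>y. {x, y}) ` {y. {x, y} \<in> edges G}"
  proof
    show "{e \<in> edges G. x \<in> e} \<subseteq> (\<lambda>y. {x, y}) ` {y. {x, y} \<in> edges G}"
    proof
      fix e
      assume e: "e \<in> {e \<in> edges G. x \<in> e}"
      then obtain a b where "e = {a, b}"
        using assms by (auto simp: simple_graph_def card_2_iff)
      then show "e \<in> (\<lambda>y. {x, y}) ` {y. {x, y} \<in> edges G}"
        using e by (auto simp: insert_commute)
    qed
  qed auto
  moreover have "inj_on (\<lambda>y. {x, y}) {y. {x, y} \<in> edges G}"
    by (auto simp: inj_on_def doubleton_eq_iff)
  ultimately show ?thesis
    by (simp add: degree_def card_image)
qed

lemma bipartite_if_no_odd_cycle: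
  assumes "simple_graph G" and "\<And>xs. cycle (\<lambda>x y. {x, y} \<in> edges G) xs \<Longrightarrow> even (length xs)"
  shows "bipartite G"
proof -
  have "symp (\<lambda>x y. {x, y} \<in> edges G)"
    by (auto intro: sympI simp: insert_commute)
  from no_odd_cycle_two_colouring[OF this assms(2)]
  obtain A where A: "\<And>x y. {x, y} \<in> edges G \<Longrightarrow> x \<in> A \<longleftrightarrow> y \<notin> A"
    by blast
  have "\<exists>a\<in>verts G \<inter> A. \<exists>b\<in>verts G - A. e = {a, b}" if e: "e \<in> edges G" for e
  proof -
    obtain x y where "e = {x, y}"
      using assms(1) e by (auto simp: simple_graph_def card_2_iff)
    moreover from this have "x \<in> verts G" "y \<in> verts G"
      using assms(1) that by (auto simp: simple_graph_def)
    ultimately show ?thesis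
      using A[of x y] that by (cases "x \<in> A") (auto simp: insert_commute)
  qed
  then show ?thesis
    unfolding bipartite_def by (intro exI[of _ "verts G \<inter> A"] exI[of _ "verts G - A"]) auto
qed

lemma contains_cycle_graph:
  assumes "simple_graph G" and cyc: "cycle (\<lambda>x y. {x, y} \<in> edges G) xs"
  shows "contains_subgraph G (cycle_graph (length xs))"
  unfolding contains_subgraph_def
proof (intro exI[of _ "\<lambda>i. xs ! i"] conjI ballI)
  have step: "{xs ! i, xs ! (Suc i mod length xs)} \<in> edges G" if "i < length xs" for i
    using cyc_nth_step[OF cyc, of i] that by (simp add: cyc_nth_def)
  show "inj_on ((!) xs) (verts (cycle_graph (length xs)))"
    using cyc by (auto simp: cycle_graph_def cycle_def inj_on_def nth_eq_iff_index_eq)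
  show "(!) xs ` verts (cycle_graph (length xs)) \<subseteq> verts G"
  proof
    fix x
    assume "x \<in> (!) xs ` verts (cycle_graph (length xs))"
    then obtain i where "i < length xs" "x = xs ! i"
      by (auto simp: cycle_graph_def)
    then show "x \<in> verts G"
      using step[of i] assms(1) by (auto simp: simple_graph_def)
  qed
  show "(!) xs ` e \<in> edges G" if "e \<in> edges (cycle_graph (length xs))" for e
    using that step by (auto simp: cycle_graph_def)
qed

theorem theorem9:
  fixes G :: "'a ugraph" and l n :: nat
  assumes "l \<ge> 2"
    and "simple_graph G"
    and "order G = n"
    and "n > ((l + 1) choose 2) * (2 * l + 1) * (3 * l - 1)"
    and "real (min_degree G) > 2 * real n / (2 * real l + 1)"
    and "\<And>F. F \<subseteq> edges G \<Longrightarrow> card F \<le> l ^ 3 \<Longrightarrow> \<not> bipartite (delete_edges G F)"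
  shows "contains_subgraph G (cycle_graph (2 * l - 1))"
proof -
  let ?E = "\<lambda>x y. {x, y} \<in> edges G"
  have fin: "finite (verts G)" and edge: "\<And>e. e \<in> edges G \<Longrightarrow> e \<subseteq> verts G \<and> card e = 2"
    using assms(2) by (auto simp: simple_graph_def)
  have "2 * real n < real (min_degree G) * (2 * real l + 1)"
    using assms(5) by (simp add: divide_less_eq)
  then have "real (2 * n) < real ((2 * l + 1) * min_degree G)"
    by (simp add: algebra_simps)
  then have min_degree: "2 * n < (2 * l + 1) * min_degree G"
    unfolding of_nat_less_iff .
  interpret linked_graph "verts G" ?E l
  proof
    show "\<not> {x, x} \<in> edges G" for x
      using edge[of "{x, x}"] by auto
  qed (use fin edge assms(1) in \<open>auto intro: sympI simp: insert_commute\<close>)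
  interpret dense_graph "verts G" ?E l
  proof
    show "((l + 1) choose 2) * (2 * l + 1) * (3 * l - 1) < card (verts G)"
      using assms(3,4) by (simp add: order_def)
    show "2 * card (verts G) < (2 * l + 1) * card (nbrs x)" if "x \<in> verts G" for x
    proof -
      have "min_degree G \<le> degree G x"
        using fin that by (simp add: min_degree_def)
      then have "(2 * l + 1) * min_degree G \<le> (2 * l + 1) * card (nbrs x)"
        unfolding nbrs_def degree_eq_card_nbrs[OF assms(2)] by (rule mult_le_mono[OF le_refl])
      then show ?thesis
        using min_degree assms(3) by (simp add: order_def)
    qed
  qed
  \<comment> \<open>Graphs without odd cycles are bipartite, so each deletion of at most
    \<open>l ^ 3\<close> edges leaves an odd cycle.\<close>
  have "\<exists>xs. good xs"
  proof (rule good_exists)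
    fix F
    assume F: "F \<subseteq> {{x, y} |x y. {x, y} \<in> edges G}" "card F \<le> l ^ 3"
    then have "\<not> bipartite (delete_edges G F)"
      by (intro assms(6)) auto
    moreover have "simple_graph (delete_edges G F)"
      using assms(2) by (auto simp: simple_graph_def delete_edges_def)
    ultimately show "\<exists>os. cycle (\<lambda>x y. {x, y} \<in> edges G \<and> {x, y} \<notin> F) os \<and> odd (length os)"
      using bipartite_if_no_odd_cycle[of "delete_edges G F"] by (auto simp: delete_edges_def)
  qed
  then obtain os where "cycle ?E os" "length os = 2 * l - 1"
    using cycle_of_good by blast
  then show ?thesis
    using contains_cycle_graph[OF assms(2)] by metis
qed

end
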